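(* Let $A\in\mathbb{R}^{n\times m}$ have rank $r$ and thin SVD $A=U\Sigma V^\top$, with $u_i,v_j\in\mathbb{R}^r$ the $i$th row of $U$ and the $j$th row of $V$. Assume $\sigma_1=1$. Let $I=(i_1,\ldots,i_k)$ be a tuple of indices in $[n]$ and $J=(j_1,\ldots,j_k)$ a tuple of indices in $[m]$, let $\ell\in[n]$, $p\in[m]$, and suppose the Euclidean norms of the vectors $u_\ell,u_{i_1},\ldots,u_{i_k},v_p,v_{j_1},\ldots,v_{j_k}$ are at most one. Let $M_1,M_2$ be integers with $k\le M_1,M_2\le r$ satisfying $$P_{M_1}u_\ell\in\operatorname{span}\{P_{M_1}u_{i_1},\ldots,P_{M_1}u_{i_k}\}\quad\text{and}\quad P_{M_2}v_p\in\operatorname{span}\{P_{M_2}v_{j_1},\ldots,P_{M_2}v_{j_k}\}.$$ Then, with $u_I=u_{i_1}\wedge\cdots\wedge u_{i_k}$ and $v_J=v_{j_1}\wedge\cdots\wedge v_{j_k}$, $$\left|\langle u_I\wedge u_\ell,\,v_J\wedge v_p\rangle_\sigma\right|\le\sqrt{\sigma_{M_1+1}\,\sigma_{M_2+1}}.$$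
   Context: Thin SVD: $U\in\mathbb{R}^{n\times r}$, $V\in\mathbb{R}^{m\times r}$ have orthonormal columns, $\Sigma=\operatorname{diag}(\sigma_1,\ldots,\sigma_r)$ with $\sigma_1\ge\cdots\ge\sigma_r>0$; convention $\sigma_{r+1}=0$. $P_M:\mathbb{R}^r\to\mathbb{R}^M$ is the projection onto the first $M$ coordinates. For $x,y\in\mathbb{R}^r$, $\langle x,y\rangle_\sigma=\sum_{q=1}^r\sigma_qx_qy_q$. On $\bigwedge^s\mathbb{R}^r$ the weighted inner product is defined on simple blades by $\langle x_1\wedge\cdots\wedge x_s,\,y_1\wedge\cdots\wedge y_s\rangle_\sigma=\det[\langle x_a,y_b\rangle_\sigma]_{a,b=1}^s$ and extended bilinearly. $[n]=\{1,\ldots,n\}$. *)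

theory Defs
  imports Complex_Main "Jordan_Normal_Form.Determinant" "Jordan_Normal_Form.DL_Rank"
begin

text \<open>Rows, columns, tuple entries and vector coordinates are numbered from 0, as usual for
  \<^typ>\<open>'a mat\<close> and \<^typ>\<open>'a vec\<close>; the singular values \<open>\<sigma> 1, \<dots>, \<sigma> r\<close> are numbered from 1, so
  that \<open>\<sigma> (Suc q)\<close> belongs to coordinate \<open>q\<close>.\<close>

definition euclid_norm :: "real vec \<Rightarrow> real" where
  "euclid_norm x = sqrt (x \<bullet> x)"

definition proj_first :: "nat \<Rightarrow> real vec \<Rightarrow> real vec" where
  "proj_first M x = vec_first x M"

abbreviation vec_span :: "nat \<Rightarrow> real vec set \<Rightarrow> real vec set" where
  "vec_span d S \<equiv> LinearCombinations.module.span class_ring (module_vec TYPE(real) d) S"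

text \<open>The last conjunct is the convention on the singular value of index \<open>r + 1\<close>.
  Values of \<open>\<sigma>\<close> outside \<open>{1..r+1}\<close> are unconstrained and never used.\<close>

definition thin_svd ::
  "nat \<Rightarrow> nat \<Rightarrow> nat \<Rightarrow> real mat \<Rightarrow> real mat \<Rightarrow> (nat \<Rightarrow> real) \<Rightarrow> real mat \<Rightarrow> bool" where
  "thin_svd n m r A U \<sigma> V \<longleftrightarrow>
     A \<in> carrier_mat n m \<and> U \<in> carrier_mat n r \<and> V \<in> carrier_mat m r \<and>
     U\<^sup>T * U = 1\<^sub>m r \<and> V\<^sup>T * V = 1\<^sub>m r \<and>
     A = U * mat_diag r (\<lambda>q. \<sigma> (Suc q)) * V\<^sup>T \<and>
     (\<forall>q q'. 1 \<le> q \<and> q \<le> q' \<and> q' \<le> r \<longrightarrow> \<sigma> q' \<le> \<sigma> q) \<and>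
     (\<forall>q. 1 \<le> q \<and> q \<le> r \<longrightarrow> 0 < \<sigma> q) \<and>
     \<sigma> (r + 1) = 0"

definition weighted_inner :: "nat \<Rightarrow> (nat \<Rightarrow> real) \<Rightarrow> real vec \<Rightarrow> real vec \<Rightarrow> real" where
  "weighted_inner r \<sigma> x y = (\<Sum>q<r. \<sigma> (Suc q) * x $ q * y $ q)"


section \<open>Exterior powers of \<open>\<real>\<^sup>r\<close>\<close>

text \<open>The \<open>s\<close>-th exterior power is realised as the dual of the space of alternating \<open>s\<close>-linear
  forms on \<open>\<real>\<^sup>r\<close>: the simple blade of \<open>x\<^sub>1, \<dots>, x\<^sub>s\<close> is evaluation of forms at
  \<open>(x\<^sub>1, \<dots>, x\<^sub>s)\<close>, and the exterior power is the linear span of the simple blades.\<close>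

definition tuples :: "nat \<Rightarrow> nat \<Rightarrow> real vec list set" where
  "tuples r s = {xs. length xs = s \<and> set xs \<subseteq> carrier_vec r}"

definition alternating_form :: "nat \<Rightarrow> nat \<Rightarrow> (real vec list \<Rightarrow> real) \<Rightarrow> bool" where
  "alternating_form r s \<omega> \<longleftrightarrow>
     (\<forall>xs\<in>tuples r s. \<forall>a<s. \<forall>y\<in>carrier_vec r. \<forall>z\<in>carrier_vec r. \<forall>c.
        \<omega> (xs[a := c \<cdot>\<^sub>v y + z]) = c * \<omega> (xs[a := y]) + \<omega> (xs[a := z])) \<and>
     (\<forall>xs\<in>tuples r s. \<forall>a<s. \<forall>b<s. a \<noteq> b \<and> xs ! a = xs ! b \<longrightarrow> \<omega> xs = 0)"

type_synonym multivector = "(real vec list \<Rightarrow> real) \<Rightarrow> real"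

definition wedge :: "nat \<Rightarrow> real vec list \<Rightarrow> multivector" where
  "wedge r xs = (\<lambda>\<omega>. if alternating_form r (length xs) \<omega> then \<omega> xs else 0)"

inductive_set ext_power :: "nat \<Rightarrow> nat \<Rightarrow> multivector set" for r s where
  zero: "(\<lambda>\<omega>. 0) \<in> ext_power r s"
| step: "xs \<in> tuples r s \<Longrightarrow> X \<in> ext_power r s \<Longrightarrow>
           (\<lambda>\<omega>. c * wedge r xs \<omega> + X \<omega>) \<in> ext_power r s"

definition gram_det ::
  "nat \<Rightarrow> nat \<Rightarrow> (nat \<Rightarrow> real) \<Rightarrow> real vec list \<Rightarrow> real vec list \<Rightarrow> real" where
  "gram_det r s \<sigma> xs ys = det (mat s s (\<lambda>(a, b). weighted_inner r \<sigma> (xs ! a) (ys ! b)))"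

text \<open>The bilinear extension of \<^const>\<open>gram_det\<close> from simple blades to the exterior power: if
  \<open>X = \<Sum>\<^sub>i c\<^sub>i x\<^sub>i\<close> and \<open>Y = \<Sum>\<^sub>j d\<^sub>j y\<^sub>j\<close> with blades \<open>x\<^sub>i\<close>, \<open>y\<^sub>j\<close>, evaluating \<open>X\<close> and then \<open>Y\<close> at the
  form \<^const>\<open>gram_det\<close> gives \<open>\<Sum>\<^sub>i\<^sub>,\<^sub>j c\<^sub>i d\<^sub>j gram_det x\<^sub>i y\<^sub>j\<close>, independently of the chosen
  representations. Lemmas \<open>ext_inner_wedge\<close>, \<open>ext_inner_linear_left\<close>, \<open>ext_inner_linear_right\<close>
  and \<open>ext_inner_unique\<close> below characterise it.\<close>

definition ext_inner :: "nat \<Rightarrow> nat \<Rightarrow> (nat \<Rightarrow> real) \<Rightarrow> multivector \<Rightarrow> multivector \<Rightarrow> real" where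
  "ext_inner r s \<sigma> X Y = Y (\<lambda>ys. X (\<lambda>xs. gram_det r s \<sigma> xs ys))"

lemma weighted_inner_sym: "weighted_inner r \<sigma> x y = weighted_inner r \<sigma> y x"
  unfolding weighted_inner_def by (intro sum.cong) auto

lemma gram_det_sym: "gram_det r s \<sigma> xs ys = gram_det r s \<sigma> ys xs"
proof -
  let ?G = "\<lambda>xs ys. mat s s (\<lambda>(a, b). weighted_inner r \<sigma> (xs ! a) (ys ! b))"
  have "det (?G xs ys) = det (transpose_mat (?G xs ys))"
    by (subst det_transpose[of _ s]) auto
  also have "transpose_mat (?G xs ys) = ?G ys xs"
    by (intro eq_matI) (auto simp: weighted_inner_sym)
  finally show ?thesis unfolding gram_det_def .
qed

lemma weighted_inner_linear:
  assumes "y \<in> carrier_vec r" "z \<in> carrier_vec r"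
  shows "weighted_inner r \<sigma> (c \<cdot>\<^sub>v y + z) w = c * weighted_inner r \<sigma> y w + weighted_inner r \<sigma> z w"
proof -
  have "weighted_inner r \<sigma> (c \<cdot>\<^sub>v y + z) w =
      (\<Sum>q<r. c * (\<sigma> (Suc q) * y $ q * w $ q) + \<sigma> (Suc q) * z $ q * w $ q)"
    using assms unfolding weighted_inner_def
    by (intro sum.cong refl) (simp add: algebra_simps)
  then show ?thesis
    by (simp only: weighted_inner_def sum.distrib sum_distrib_left)
qed

lemma alternating_form_gram_det: "alternating_form r s (\<lambda>xs. gram_det r s \<sigma> xs ys)"
  unfolding alternating_form_def
proof (intro conjI ballI allI impI)
  fix xs a c and y z :: "real vec"
  assume xs: "xs \<in> tuples r s" and a: "a < s"
    and y: "y \<in> carrier_vec r" and z: "z \<in> carrier_vec r"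
  let ?g = "\<lambda>v. vec s (\<lambda>b. weighted_inner r \<sigma> v (ys ! b))"
  let ?M = "\<lambda>w. mat\<^sub>r s s (\<lambda>i. if i = a then w else ?g (xs ! i))"
  have M: "gram_det r s \<sigma> (xs[a := v]) ys = det (?M (?g v))" for v
    unfolding gram_det_def using xs a unfolding tuples_def
    by (intro arg_cong[of _ _ det] eq_matI) (auto simp: nth_list_update)
  have g: "?g (c \<cdot>\<^sub>v y + z) = c \<cdot>\<^sub>v ?g y + ?g z"
    using y z by (intro eq_vecI) (auto simp: weighted_inner_linear)
  have "det (?M (c \<cdot>\<^sub>v ?g y + ?g z)) = det (?M (c \<cdot>\<^sub>v ?g y)) + det (?M (?g z))"
    by (rule det_row_add[of "\<lambda>i. c \<cdot>\<^sub>v ?g y" a s "\<lambda>i. ?g z" "\<lambda>i. ?g (xs ! i)"]) (use a in auto)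
  also have "?M (c \<cdot>\<^sub>v ?g y) = multrow a c (?M (?g y))"
    using a by (intro eq_matI) auto
  also have "det \<dots> = c * det (?M (?g y))"
    by (rule det_multrow) (use a in auto)
  finally show "gram_det r s \<sigma> (xs[a := c \<cdot>\<^sub>v y + z]) ys =
      c * gram_det r s \<sigma> (xs[a := y]) ys + gram_det r s \<sigma> (xs[a := z]) ys"
    unfolding M g .
next
  fix xs a b
  assume "xs \<in> tuples r s" "a < s" "b < s" and ab: "a \<noteq> b \<and> xs ! a = xs ! b"
  then show "gram_det r s \<sigma> xs ys = 0"
    unfolding gram_det_def
    by (intro det_identical_rows[of _ s a b]) (auto intro!: eq_vecI)
qed

lemma alternating_form_lin:
  assumes "alternating_form r s \<omega>" "alternating_form r s \<eta>"
  shows "alternating_form r s (\<lambda>xs. c * \<omega> xs + \<eta> xs)"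
  unfolding alternating_form_def
proof (intro conjI ballI allI impI)
  fix xs a d and y z :: "real vec"
  assume "xs \<in> tuples r s" "a < s" "y \<in> carrier_vec r" "z \<in> carrier_vec r"
  then have "\<omega> (xs[a := d \<cdot>\<^sub>v y + z]) = d * \<omega> (xs[a := y]) + \<omega> (xs[a := z])"
    and "\<eta> (xs[a := d \<cdot>\<^sub>v y + z]) = d * \<eta> (xs[a := y]) + \<eta> (xs[a := z])"
    using assms unfolding alternating_form_def by blast+
  then show "c * \<omega> (xs[a := d \<cdot>\<^sub>v y + z]) + \<eta> (xs[a := d \<cdot>\<^sub>v y + z]) =
      d * (c * \<omega> (xs[a := y]) + \<eta> (xs[a := y])) + (c * \<omega> (xs[a := z]) + \<eta> (xs[a := z]))"
    by (simp only:) (simp add: algebra_simps)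
next
  fix xs a b
  assume "xs \<in> tuples r s" "a < s" "b < s" "a \<noteq> b \<and> xs ! a = xs ! b"
  then have "\<omega> xs = 0" "\<eta> xs = 0"
    using assms unfolding alternating_form_def by blast+
  then show "c * \<omega> xs + \<eta> xs = 0" by simp
qed

lemma ext_power_eval_lin:
  assumes "X \<in> ext_power r s" "alternating_form r s \<omega>" "alternating_form r s \<eta>"
  shows "X (\<lambda>xs. c * \<omega> xs + \<eta> xs) = c * X \<omega> + X \<eta>"
  using assms(1)
proof induction
  case zero
  show ?case by simp
next
  case (step xs X d)
  from step.hyps(1) have "wedge r xs (\<lambda>xs. c * \<omega> xs + \<eta> xs) = c * wedge r xs \<omega> + wedge r xs \<eta>"
    using assms(2,3) alternating_form_lin[OF assms(2,3), of c] by (simp add: wedge_def tuples_def)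
  then show ?case by (simp only: step.IH) (simp add: algebra_simps)
qed

lemma alternating_form_eval:
  assumes "X \<in> ext_power r s"
  shows "alternating_form r s (\<lambda>ys. X (\<lambda>xs. gram_det r s \<sigma> xs ys))"
  using assms
proof induction
  case zero
  show ?case by (simp add: alternating_form_def)
next
  case (step zs X c)
  have "alternating_form r s (\<lambda>ys. gram_det r s \<sigma> zs ys)"
    using alternating_form_gram_det[of r s \<sigma> zs] by (simp add: gram_det_sym[of r s \<sigma> zs])
  from alternating_form_lin[OF this step.IH, of c] step.hyps show ?case
    by (simp add: wedge_def tuples_def alternating_form_gram_det)
qed

lemma wedge_in_ext_power: "xs \<in> tuples r s \<Longrightarrow> wedge r xs \<in> ext_power r s"
  using ext_power.step[OF _ ext_power.zero, of xs r s 1] by simp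

lemma ext_inner_wedge:
  assumes "xs \<in> tuples r s" "ys \<in> tuples r s"
  shows "ext_inner r s \<sigma> (wedge r xs) (wedge r ys) =
           det (mat s s (\<lambda>(a, b). weighted_inner r \<sigma> (xs ! a) (ys ! b)))"
proof -
  have "ext_inner r s \<sigma> (wedge r xs) (wedge r ys) = gram_det r s \<sigma> xs ys"
    using assms alternating_form_eval[OF wedge_in_ext_power[OF assms(1)], of \<sigma>]
    unfolding ext_inner_def by (simp add: wedge_def tuples_def alternating_form_gram_det)
  then show ?thesis by (simp add: gram_det_def)
qed

lemma ext_inner_linear_left:
  assumes "X \<in> ext_power r s" "X' \<in> ext_power r s" "Y \<in> ext_power r s"
  shows "ext_inner r s \<sigma> (\<lambda>\<omega>. c * X \<omega> + X' \<omega>) Y = c * ext_inner r s \<sigma> X Y + ext_inner r s \<sigma> X' Y"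
  unfolding ext_inner_def
  by (rule ext_power_eval_lin[OF assms(3) alternating_form_eval[OF assms(1)]
        alternating_form_eval[OF assms(2)]])

lemma ext_inner_linear_right:
  "ext_inner r s \<sigma> X (\<lambda>\<omega>. c * Y \<omega> + Y' \<omega>) = c * ext_inner r s \<sigma> X Y + ext_inner r s \<sigma> X Y'"
  unfolding ext_inner_def ..

lemma ext_inner_unique:
  fixes B :: "multivector \<Rightarrow> multivector \<Rightarrow> real"
  assumes left: "\<And>X X' Y c. X \<in> ext_power r s \<Longrightarrow> X' \<in> ext_power r s \<Longrightarrow> Y \<in> ext_power r s \<Longrightarrow>
      B (\<lambda>\<omega>. c * X \<omega> + X' \<omega>) Y = c * B X Y + B X' Y"
    and right: "\<And>X Y Y' c. X \<in> ext_power r s \<Longrightarrow> Y \<in> ext_power r s \<Longrightarrow> Y' \<in> ext_power r s \<Longrightarrow>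
      B X (\<lambda>\<omega>. c * Y \<omega> + Y' \<omega>) = c * B X Y + B X Y'"
    and blades: "\<And>xs ys. xs \<in> tuples r s \<Longrightarrow> ys \<in> tuples r s \<Longrightarrow>
      B (wedge r xs) (wedge r ys) =
        det (mat s s (\<lambda>(a, b). weighted_inner r \<sigma> (xs ! a) (ys ! b)))"
    and X: "X \<in> ext_power r s" and Y: "Y \<in> ext_power r s"
  shows "B X Y = ext_inner r s \<sigma> X Y"
proof -
  have z: "(\<lambda>\<omega>. 0) \<in> ext_power r s" by (rule ext_power.zero)
  have B0: "B (\<lambda>\<omega>. 0) Y = 0" "B Y (\<lambda>\<omega>. 0) = 0" if "Y \<in> ext_power r s" for Y
    using left[OF z z that, of 1] right[OF that z z, of 1] by simp_all
  have I0: "ext_inner r s \<sigma> (\<lambda>\<omega>. 0) Y = 0" "ext_inner r s \<sigma> Y (\<lambda>\<omega>. 0) = 0"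
    if "Y \<in> ext_power r s" for Y
    using ext_inner_linear_left[OF z z that, of \<sigma> 1] by (simp_all add: ext_inner_def)
  have *: "B (wedge r xs) Y = ext_inner r s \<sigma> (wedge r xs) Y" if xs: "xs \<in> tuples r s" for xs
    using Y
  proof induction
    case zero
    show ?case using B0 I0 wedge_in_ext_power[OF xs] by simp
  next
    case (step ys Y c)
    then show ?case
      using right[OF wedge_in_ext_power[OF xs] wedge_in_ext_power[OF step.hyps(1)] step.hyps(2), of c]
        blades[OF xs step.hyps(1)] ext_inner_wedge[OF xs step.hyps(1), of \<sigma>]
      by (simp add: ext_inner_linear_right)
  qed
  show ?thesis
    using X
  proof induction
    case zero
    show ?case using B0 I0 Y by simp
  next
    case (step xs X c)
    then show ?case
      using left[OF wedge_in_ext_power[OF step.hyps(1)] step.hyps(2) Y, of c]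
        ext_inner_linear_left[OF wedge_in_ext_power[OF step.hyps(1)] step.hyps(2) Y, of \<sigma> c]
        *[OF step.hyps(1)]
      by simp
  qed
qed

end

theory Submission
  imports Defs "HOL-Analysis.L2_Norm"
begin

text \<open>The pairing of the two blades is the determinant of \<open>X D Y\<^sup>T\<close>, where \<open>X\<close> and \<open>Y\<close> have the
  vectors \<open>u\<^sub>I, u\<^sub>l\<close> and \<open>v\<^sub>J, v\<^sub>p\<close> as rows and \<open>D\<close> is the diagonal matrix of the singular values. The
  Cauchy--Binet formula (\<open>symmetrised_cauchy_binet\<close>) writes \<open>det (X D Y\<^sup>T)\<close>, up to the
  factor \<open>fact (k + 1)\<close>, as a sum, over choices \<open>f\<close> of \<open>k + 1\<close> columns, of the product of the chosen singular values with the corresponding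
  minors of \<open>X\<close> and \<open>Y\<close>. Since the weights are nonnegative, the Cauchy--Schwarz inequality for this sum
  gives \<open>\<bar>det (X D Y\<^sup>T)\<bar> \<le> sqrt (det (X D X\<^sup>T) * det (Y D Y\<^sup>T))\<close>
  (\<open>mixed_gram_det_cauchy_schwarz\<close>), so it remains to show
  \<open>det (X D X\<^sup>T) \<le> \<sigma> (M1 + 1)\<close>, and the same for \<open>Y\<close> and \<open>M2\<close>.

  The span hypothesis says that the last row of \<open>X\<close> depends on the others as far as the first
  \<open>M1\<close> columns are concerned. Hence a minor of \<open>X\<close> vanishes unless it uses a column beyond these
  (\<open>column_minor_dependent_last_row\<close>), and the weight of every surviving term is at most
  \<open>\<sigma> (M1 + 1)\<close>, as all singular values are at most \<open>\<sigma> 1 = 1\<close>. Comparing with the unweighted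
  Cauchy--Binet sum, \<open>det (X D X\<^sup>T) \<le> \<sigma> (M1 + 1) * det (X X\<^sup>T)\<close>
  (\<open>mixed_gram_det_le_of_vanishing_minors\<close>). Finally \<open>det (X X\<^sup>T) \<le> 1\<close> by Hadamard's
  inequality (\<open>hadamard_gram\<close>), because the rows have norm at most one.\<close>

section \<open>A symmetrised Cauchy--Binet formula\<close>

text \<open>All maps from the \<open>s\<close> row positions to the \<open>r\<close> columns, injective or not. They are
  total functions, extended by the identity outside \<open>{0..<s}\<close>, as in \<open>det_linear_rows_sum\<close>.\<close>

definition column_choices :: "nat \<Rightarrow> nat \<Rightarrow> (nat \<Rightarrow> nat) set" where
  "column_choices s r = {f. (\<forall>a\<in>{0..<s}. f a \<in> {..<r}) \<and> (\<forall>a. a \<notin> {0..<s} \<longrightarrow> f a = a)}"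

text \<open>A matrix is given by its entries \<open>x a q\<close> in row \<open>a\<close> and column \<open>q\<close>. The minor of its first \<open>s\<close>
  rows for the choice \<open>f\<close> takes the columns \<open>f 0, \<dots>, f (s - 1)\<close> in this order, so that it
  carries a sign and vanishes if \<open>f\<close> repeats a column.\<close>

definition column_minor :: "nat \<Rightarrow> (nat \<Rightarrow> nat \<Rightarrow> 'a::comm_ring_1) \<Rightarrow> (nat \<Rightarrow> nat) \<Rightarrow> 'a" where
  "column_minor s x f = det (mat s s (\<lambda>(a, b). x a (f b)))"

text \<open>The determinant of \<open>X D Y\<^sup>T\<close> for \<open>s \<times> r\<close> matrices \<open>X\<close>, \<open>Y\<close> with entries \<open>x\<close>, \<open>y\<close> and the
  diagonal matrix \<open>D\<close> with entries \<open>w\<close>. For \<open>x = y\<close> and constant weight 1 it is the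
  Gram determinant of the rows of \<open>X\<close>.\<close>

definition mixed_gram_det ::
  "nat \<Rightarrow> nat \<Rightarrow> (nat \<Rightarrow> 'a) \<Rightarrow> (nat \<Rightarrow> nat \<Rightarrow> 'a) \<Rightarrow> (nat \<Rightarrow> nat \<Rightarrow> 'a) \<Rightarrow> 'a::comm_ring_1" where
  "mixed_gram_det s r w x y = det (mat s s (\<lambda>(a, b). \<Sum>q<r. w q * x a q * y b q))"

lemma finite_column_choices [simp]: "finite (column_choices s r)"
  unfolding column_choices_def by (rule finite_bounded_functions) auto

lemma column_choices_compose_permutes:
  assumes "p permutes {0..<s}"
  shows "bij_betw (\<lambda>f. f \<circ> p) (column_choices s r) (column_choices s r)"
proof (rule bij_betwI[where g = "\<lambda>f. f \<circ> inv_into UNIV p"])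
  have closed: "f \<circ> q \<in> column_choices s r"
    if "q permutes {0..<s}" "f \<in> column_choices s r" for f q
    using that permutes_in_image[OF that(1)] permutes_not_in[OF that(1)]
    by (auto simp: column_choices_def)
  show "(\<lambda>f. f \<circ> p) \<in> column_choices s r \<rightarrow> column_choices s r"
    and "(\<lambda>f. f \<circ> inv_into UNIV p) \<in> column_choices s r \<rightarrow> column_choices s r"
    using closed[OF assms] closed[OF permutes_inv[OF assms]] by auto
qed (simp_all add: comp_assoc permutes_inv_o[OF assms])

lemma column_minor_compose_permutes:
  assumes "p permutes {0..<s}"
  shows "column_minor s x (f \<circ> p) = signof p * column_minor s x f"
proof -
  let ?N = "mat s s (\<lambda>(b, a). x a (f b))"
  have "column_minor s x (f \<circ> p) = det (mat s s (\<lambda>(b, a). x a (f (p b))))"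
    unfolding column_minor_def
    by (subst det_transpose[of _ s, symmetric]) (auto intro!: arg_cong[of _ _ det])
  also have "mat s s (\<lambda>(b, a). x a (f (p b))) = mat s s (\<lambda>(b, a). ?N $$ (p b, a))"
    using permutes_in_image[OF assms] by (intro eq_matI) auto
  also have "det \<dots> = signof p * det ?N"
    by (rule det_permute_rows[OF _ assms]) simp
  also have "det ?N = column_minor s x f"
    unfolding column_minor_def
    by (subst det_transpose[of _ s, symmetric]) (auto intro!: arg_cong[of _ _ det])
  finally show ?thesis .
qed

lemma mixed_gram_det_row_expansion:
  "mixed_gram_det s r w x y =
     (\<Sum>f\<in>column_choices s r. (\<Prod>a<s. w (f a)) * (\<Prod>a<s. x a (f a)) * column_minor s y f)"
proof -
  let ?v = "\<lambda>a q. (w q * x a q) \<cdot>\<^sub>v vec s (\<lambda>b. y b q)"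
  have "mixed_gram_det s r w x y =
      det (mat\<^sub>r s s (\<lambda>a. finsum_vec TYPE('a) s (?v a) {..<r}))"
    unfolding mixed_gram_det_def
    by (intro arg_cong[of _ _ det] eq_matI) (auto simp: index_finsum_vec intro!: sum.cong)
  also have "\<dots> = (\<Sum>f\<in>column_choices s r. det (mat\<^sub>r s s (\<lambda>a. ?v a (f a))))"
    unfolding column_choices_def by (rule det_linear_rows_sum) auto
  also have "\<dots> = (\<Sum>f\<in>column_choices s r.
      (\<Prod>a<s. w (f a)) * (\<Prod>a<s. x a (f a)) * column_minor s y f)"
  proof (rule sum.cong[OF refl])
    fix f
    have "det (mat\<^sub>r s s (\<lambda>a. ?v a (f a))) = (\<Prod>a\<in>{0..<s}. w (f a) * x a (f a)) *
        det (mat\<^sub>r s s (\<lambda>a. vec s (\<lambda>b. y b (f a))))"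
      by (rule det_rows_mul) auto
    also have "det (mat\<^sub>r s s (\<lambda>a. vec s (\<lambda>b. y b (f a)))) = column_minor s y f"
      unfolding column_minor_def
      by (subst det_transpose[of _ s, symmetric]) (auto intro!: arg_cong[of _ _ det])
    finally show "det (mat\<^sub>r s s (\<lambda>a. ?v a (f a))) =
        (\<Prod>a<s. w (f a)) * (\<Prod>a<s. x a (f a)) * column_minor s y f"
      by (simp add: prod.distrib atLeast0LessThan)
  qed
  finally show ?thesis .
qed

text \<open>Summing over all choices of columns instead of the increasing ones counts every set of \<open>s\<close>
  columns \<open>fact s\<close> times. The proof averages \<open>mixed_gram_det_row_expansion\<close> over the permutations of
  the row positions: reordering the choice by \<open>p\<close> multiplies the minor of \<open>y\<close> by the sign of
  \<open>p\<close>, and the signed sum of the products of entries of \<open>x\<close> is the minor of \<open>x\<close>.\<close>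

theorem symmetrised_cauchy_binet:
  "of_nat (fact s) * mixed_gram_det s r w x y =
     (\<Sum>f\<in>column_choices s r. (\<Prod>a<s. w (f a)) * column_minor s x f * column_minor s y f)"
proof -
  let ?F = "column_choices s r" and ?P = "{p. p permutes {0..<s}}"
  let ?h = "\<lambda>f. (\<Prod>a<s. w (f a)) * (\<Prod>a<s. x a (f a)) * column_minor s y f"
  have inv: "mixed_gram_det s r w x y = (\<Sum>f\<in>?F. (\<Prod>a<s. w (f a)) *
      (signof p * (\<Prod>a<s. x a (f (p a)))) * column_minor s y f)" if p: "p \<in> ?P" for p
  proof -
    from p have p: "p permutes {0..<s}" by simp
    have "mixed_gram_det s r w x y = (\<Sum>f\<in>?F. ?h (f \<circ> p))"
      unfolding mixed_gram_det_row_expansion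
      by (rule sum.reindex_bij_betw[OF column_choices_compose_permutes[OF p], symmetric])
    also have "\<dots> = (\<Sum>f\<in>?F. (\<Prod>a<s. w (f a)) *
      (signof p * (\<Prod>a<s. x a (f (p a)))) * column_minor s y f)"
    proof (rule sum.cong[OF refl])
      fix f
      have "(\<Prod>a<s. w ((f \<circ> p) a)) = (\<Prod>a<s. w (f a))"
        using prod.reindex_bij_betw[OF permutes_imp_bij[OF p], of "\<lambda>a. w (f a)"]
        by (simp add: atLeast0LessThan)
      then show "?h (f \<circ> p) = (\<Prod>a<s. w (f a)) *
          (signof p * (\<Prod>a<s. x a (f (p a)))) * column_minor s y f"
        unfolding column_minor_compose_permutes[OF p] by (simp add: mult_ac)
    qed
    finally show ?thesis .
  qed
  have minor: "column_minor s x f = (\<Sum>p\<in>?P. signof p * (\<Prod>a<s. x a (f (p a))))" for f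
    unfolding column_minor_def
    by (subst det_def'[of _ s])
      (auto simp: atLeast0LessThan permutes_in_image intro!: sum.cong prod.cong arg_cong2[of _ _ _ _ "(*)"])
  have "of_nat (fact s) * mixed_gram_det s r w x y = (\<Sum>p\<in>?P. mixed_gram_det s r w x y)"
    by (simp add: card_permutations[of "{0..<s}" s])
  also have "\<dots> = (\<Sum>p\<in>?P. \<Sum>f\<in>?F. (\<Prod>a<s. w (f a)) *
      (signof p * (\<Prod>a<s. x a (f (p a)))) * column_minor s y f)"
    by (rule sum.cong[OF refl inv])
  also have "\<dots> = (\<Sum>f\<in>?F. \<Sum>p\<in>?P. (\<Prod>a<s. w (f a)) *
      (signof p * (\<Prod>a<s. x a (f (p a)))) * column_minor s y f)"
    by (rule sum.swap)
  also have "\<dots> = (\<Sum>f\<in>?F. (\<Prod>a<s. w (f a)) * column_minor s x f * column_minor s y f)"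
    unfolding minor by (simp add: sum_distrib_left sum_distrib_right)
  finally show ?thesis .
qed

section \<open>Gram determinants over the reals\<close>

lemma mixed_gram_det_self_nonneg:
  fixes x :: "nat \<Rightarrow> nat \<Rightarrow> real"
  assumes "\<And>q. q < r \<Longrightarrow> 0 \<le> w q"
  shows "0 \<le> mixed_gram_det s r w x x"
proof -
  have "0 \<le> (\<Sum>f\<in>column_choices s r. (\<Prod>a<s. w (f a)) * column_minor s x f * column_minor s x f)"
    unfolding mult.assoc
  proof (rule sum_nonneg)
    fix f assume "f \<in> column_choices s r"
    then have "0 \<le> (\<Prod>a<s. w (f a))"
      using assms by (intro prod_nonneg) (auto simp: column_choices_def)
    then show "0 \<le> (\<Prod>a<s. w (f a)) * (column_minor s x f * column_minor s x f)"
      by (rule mult_nonneg_nonneg) (rule zero_le_square)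
  qed
  then have "0 \<le> fact s * mixed_gram_det s r w x x"
    using symmetrised_cauchy_binet[of s r w x x] by simp
  then show ?thesis using zero_le_mult_iff[of "fact s :: real" "mixed_gram_det s r w x x"]
      fact_gt_zero[of s, where 'a = real]
    by linarith
qed

lemma mixed_gram_det_cauchy_schwarz:
  fixes x y :: "nat \<Rightarrow> nat \<Rightarrow> real"
  assumes w: "\<And>q. q < r \<Longrightarrow> 0 \<le> w q"
  shows "\<bar>mixed_gram_det s r w x y\<bar> \<le>
    sqrt (mixed_gram_det s r w x x * mixed_gram_det s r w y y)"
proof -
  let ?F = "column_choices s r"
  let ?g = "\<lambda>x f. sqrt (\<Prod>a<s. w (f a)) * column_minor s x f"
  have W: "0 \<le> (\<Prod>a<s. w (f a))" if "f \<in> ?F" for f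
    using that w by (auto simp: column_choices_def intro!: prod_nonneg)
  have sum: "fact s * mixed_gram_det s r w x y = (\<Sum>f\<in>?F. ?g x f * ?g y f)" for x y
  proof -
    have "fact s * mixed_gram_det s r w x y =
        (\<Sum>f\<in>?F. (\<Prod>a<s. w (f a)) * column_minor s x f * column_minor s y f)"
      using symmetrised_cauchy_binet[of s r w x y] by simp
    also have "\<dots> = (\<Sum>f\<in>?F. ?g x f * ?g y f)"
    proof (rule sum.cong[OF refl])
      fix f assume "f \<in> ?F"
      from W[OF this] have "sqrt (\<Prod>a<s. w (f a)) * sqrt (\<Prod>a<s. w (f a)) = (\<Prod>a<s. w (f a))"
        by simp
      then show "(\<Prod>a<s. w (f a)) * column_minor s x f * column_minor s y f = ?g x f * ?g y f"
        by (metis mult.assoc mult.left_commute)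
    qed
    finally show ?thesis .
  qed
  have L2: "L2_set (?g x) ?F = sqrt (fact s * mixed_gram_det s r w x x)" for x
    unfolding L2_set_def sum by (simp add: power2_eq_square)
  have "fact s * \<bar>mixed_gram_det s r w x y\<bar> = \<bar>\<Sum>f\<in>?F. ?g x f * ?g y f\<bar>"
    unfolding sum[symmetric] by (simp add: abs_mult)
  also have "\<dots> \<le> (\<Sum>f\<in>?F. \<bar>?g x f\<bar> * \<bar>?g y f\<bar>)"
    unfolding abs_mult[symmetric] by (rule sum_abs)
  also have "\<dots> \<le> L2_set (?g x) ?F * L2_set (?g y) ?F"
    by (rule L2_set_mult_ineq)
  also have "\<dots> = fact s * sqrt (mixed_gram_det s r w x x * mixed_gram_det s r w y y)"
    unfolding L2 by (simp add: real_sqrt_mult)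
  finally show ?thesis by simp
qed

lemma mixed_gram_det_le_of_vanishing_minors:
  fixes x :: "nat \<Rightarrow> nat \<Rightarrow> real"
  assumes w: "\<And>q. q < r \<Longrightarrow> 0 \<le> w q \<and> w q \<le> 1"
    and t: "\<And>q. M \<le> q \<Longrightarrow> q < r \<Longrightarrow> w q \<le> t"
    and vanish: "\<And>f. f \<in> column_choices s r \<Longrightarrow> (\<And>a. a < s \<Longrightarrow> f a < M) \<Longrightarrow> column_minor s x f = 0"
  shows "mixed_gram_det s r w x x \<le> t * mixed_gram_det s r (\<lambda>_. 1) x x"
proof -
  let ?F = "column_choices s r"
  have "(\<Prod>a<s. w (f a)) * column_minor s x f * column_minor s x f
      \<le> t * (column_minor s x f * column_minor s x f)" if f: "f \<in> ?F" for f
  proof (cases "\<forall>a<s. f a < M")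
    case True
    then show ?thesis using vanish[OF f] by simp
  next
    case False
    then obtain c where c: "c < s" "M \<le> f c" by auto
    have fr: "f a < r" if "a < s" for a using f that by (auto simp: column_choices_def)
    have "(\<Prod>a<s. w (f a)) = w (f c) * (\<Prod>a\<in>{..<s} - {c}. w (f a))"
      using c by (intro prod.remove) auto
    also have "\<dots> \<le> w (f c)"
      using w fr c by (intro mult_left_le prod_le_1) auto
    also have "\<dots> \<le> t" using t c fr by blast
    finally show ?thesis unfolding mult.assoc by (rule mult_right_mono) simp
  qed
  then have "(\<Sum>f\<in>?F. (\<Prod>a<s. w (f a)) * column_minor s x f * column_minor s x f)
      \<le> (\<Sum>f\<in>?F. t * (column_minor s x f * column_minor s x f))"
    by (rule sum_mono)
  then have "fact s * mixed_gram_det s r w x x \<le> t * (fact s * mixed_gram_det s r (\<lambda>_. 1) x x)"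
    using symmetrised_cauchy_binet[of s r w x x] symmetrised_cauchy_binet[of s r "\<lambda>_. 1" x x]
    by (simp add: sum_distrib_left)
  then have "fact s * mixed_gram_det s r w x x \<le> fact s * (t * mixed_gram_det s r (\<lambda>_. 1) x x)"
    by (simp add: mult_ac)
  then show ?thesis by (subst (asm) mult_le_cancel_left_pos) auto
qed

lemma gram_quadratic_form:
  fixes x :: "nat \<Rightarrow> nat \<Rightarrow> real"
  shows "(\<Sum>a<s. c a * (\<Sum>b<s. (\<Sum>q<r. x a q * x b q) * c b)) = (\<Sum>q<r. (\<Sum>a<s. c a * x a q)\<^sup>2)"
proof -
  have "(\<Sum>q<r. (\<Sum>a<s. c a * x a q)\<^sup>2) = (\<Sum>q<r. \<Sum>a<s. \<Sum>b<s. c a * x a q * (c b * x b q))"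
    by (simp add: power2_eq_square sum_product)
  also have "\<dots> = (\<Sum>a<s. \<Sum>q<r. \<Sum>b<s. c a * x a q * (c b * x b q))"
    by (rule sum.swap)
  also have "\<dots> = (\<Sum>a<s. \<Sum>b<s. \<Sum>q<r. c a * x a q * (c b * x b q))"
    by (intro sum.cong refl sum.swap)
  finally show ?thesis by (simp add: sum_distrib_left sum_distrib_right mult_ac)
qed

text \<open>Adding a vector multiplies a Gram determinant by at most its squared norm. Let \<open>G\<close> be the
  Gram matrix of the old vectors and \<open>M t\<close> that of all of them, with \<open>t\<close> in place of its last
  diagonal entry. The determinant \<open>det (M t)\<close> is affine in \<open>t\<close> with slope \<open>det G \<ge> 0\<close>. If
  \<open>G\<close> is invertible and \<open>G c\<close> is the vector of inner products with the new vector, then \<open>M t\<close> is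
  singular for \<open>t = c\<^sup>T G c\<close>, the squared norm of the projection of the new vector to the span of
  the old ones, and \<open>t \<ge> 0\<close>. If \<open>G\<close> is singular, the old vectors are dependent and both sides
  vanish.\<close>

lemma gram_det_Suc_le:
  fixes x :: "nat \<Rightarrow> nat \<Rightarrow> real"
  shows "mixed_gram_det (Suc s) r (\<lambda>_. 1) x x \<le>
    (\<Sum>q<r. (x s q)\<^sup>2) * mixed_gram_det s r (\<lambda>_. 1) x x"
proof -
  define ip where "ip a b = (\<Sum>q<r. x a q * x b q)" for a b
  define G where "G = mat s s (\<lambda>(a, b). ip a b)"
  define M where "M t = mat (Suc s) (Suc s) (\<lambda>(a, b). if a = s \<and> b = s then t else ip a b)" for t
  have G [simp]: "G \<in> carrier_mat s s" and M [simp]: "M t \<in> carrier_mat (Suc s) (Suc s)" for t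
    by (simp_all add: G_def M_def)
  have detG: "mixed_gram_det s r (\<lambda>_. 1) x x = det G"
    by (simp add: mixed_gram_det_def G_def ip_def)
  have detM: "mixed_gram_det (Suc s) r (\<lambda>_. 1) x x = det (M (ip s s))"
    unfolding mixed_gram_det_def M_def ip_def
    by (intro arg_cong[of _ _ det] eq_matI) auto
  have nonneg: "0 \<le> det G"
    using mixed_gram_det_self_nonneg[of r "\<lambda>_. 1" s x] unfolding detG by simp
  have norm: "(\<Sum>q<r. (x s q)\<^sup>2) = ip s s" by (simp add: ip_def power2_eq_square)
  have sym: "ip a b = ip b a" for a b by (simp add: ip_def mult.commute)
  have corner: "det (M t) = det (M t') + (t - t') * det G" for t t'
  proof -
    have del: "mat_delete (M t) s b = mat_delete (M t') s b" for t t' b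
      by (intro eq_matI) (auto simp: mat_delete_def M_def)
    have delG: "mat_delete (M t) s s = G" for t
      by (intro eq_matI) (auto simp: mat_delete_def M_def G_def)
    have "det (M t) = t * det G + (\<Sum>b<s. ip s b * cofactor (M t) s b)" for t
    proof -
      have entry: "M t $$ (s, b) = (if b = s then t else ip s b)" if "b < Suc s" for b
        using that by (simp add: M_def)
      have "cofactor (M t) s s = det G" by (simp add: cofactor_def delG)
      then show ?thesis
        by (subst laplace_expansion_row[of _ "Suc s" s]) (simp_all add: lessThan_Suc entry)
    qed
    moreover have "cofactor (M t) s b = cofactor (M t') s b" for b
      unfolding cofactor_def del[of t b t'] ..
    ultimately show ?thesis by (simp add: algebra_simps)
  qed
  have kernel: "det (M t) = 0"
    if "\<exists>a\<le>s. c a \<noteq> 0"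
      and top: "\<And>a. a < s \<Longrightarrow> (\<Sum>b<s. ip a b * c b) + ip a s * c s = 0"
      and bot: "(\<Sum>b<s. ip s b * c b) + t * c s = 0" for t and c :: "nat \<Rightarrow> real"
  proof -
    have "vec (Suc s) c \<noteq> 0\<^sub>v (Suc s)"
      using that(1) by (metis index_vec index_zero_vec(1) less_Suc_eq_le)
    moreover have "M t *\<^sub>v vec (Suc s) c = 0\<^sub>v (Suc s)"
    proof (rule eq_vecI)
      fix a assume "a < dim_vec (0\<^sub>v (Suc s) :: real vec)"
      then have a: "a < Suc s" by simp
      then have "(M t *\<^sub>v vec (Suc s) c) $ a =
          (\<Sum>b<s. ip a b * c b) + (if a = s then t else ip a s) * c s"
        by (auto simp: M_def scalar_prod_def atLeast0LessThan lessThan_Suc intro!: sum.cong)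
      also have "\<dots> = 0" using top[of a] bot a by (cases "a = s") auto
      finally show "(M t *\<^sub>v vec (Suc s) c) $ a = 0\<^sub>v (Suc s) $ a" using a by simp
    qed (simp add: M_def)
    ultimately show ?thesis
      by (subst det_0_iff_vec_prod_zero[OF M]) (auto intro!: exI[of _ "vec (Suc s) c"])
  qed
  show ?thesis
  proof (cases "det G = 0")
    case True
    then obtain v where v: "v \<in> carrier_vec s" "v \<noteq> 0\<^sub>v s" and Gv: "G *\<^sub>v v = 0\<^sub>v s"
      using det_0_iff_vec_prod_zero[OF G] by auto
    \<comment> \<open>As \<open>v\<^sup>T G v = 0\<close>, the vectors themselves satisfy the linear relation \<open>v\<close>, which
        therefore also kills the last row of the larger matrix.\<close>
    have row: "(\<Sum>b<s. ip a b * v $ b) = 0" if "a < s" for a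
      using arg_cong[OF Gv, of "\<lambda>u. u $ a"] that v(1)
      by (simp add: G_def scalar_prod_def atLeast0LessThan)
    have "(\<Sum>q<r. (\<Sum>a<s. v $ a * x a q)\<^sup>2) = 0"
      using row unfolding gram_quadratic_form[symmetric] ip_def by simp
    then have zero: "(\<Sum>a<s. v $ a * x a q) = 0" if "q < r" for q
      using that by (subst (asm) sum_nonneg_eq_0_iff) auto
    have "(\<Sum>b<s. ip s b * v $ b) = (\<Sum>b<s. \<Sum>q<r. x s q * (v $ b * x b q))"
      by (simp add: ip_def sum_distrib_left sum_distrib_right mult_ac)
    also have "\<dots> = (\<Sum>q<r. x s q * (\<Sum>b<s. v $ b * x b q))"
      unfolding sum_distrib_left by (rule sum.swap)
    also have "\<dots> = 0" using zero by simp
    finally have bot: "(\<Sum>b<s. ip s b * v $ b) = 0" .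
    obtain a where a: "a < s" "v $ a \<noteq> 0"
      using v by (metis carrier_vecD eq_vecI index_zero_vec)
    have "det (M (ip s s)) = 0"
      by (rule kernel[of "\<lambda>a. if a < s then v $ a else 0"])
        (use row bot a in \<open>auto intro!: exI[of _ a]\<close>)
    then show ?thesis by (simp add: detG detM True)
  next
    case False
    then have "G \<in> Units (ring_mat TYPE(real) s ())"
      by (rule det_non_zero_imp_unit[OF G])
    then obtain H where H: "H \<in> carrier_mat s s" "G * H = 1\<^sub>m s"
      by (auto simp: Units_def ring_mat_def)
    define b where "b = vec s (\<lambda>a. ip a s)"
    define c where "c = H *\<^sub>v b"
    have b: "b \<in> carrier_vec s" and c: "c \<in> carrier_vec s"
      using H by (auto simp: b_def c_def)
    have Gc: "G *\<^sub>v c = b"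
      unfolding c_def using assoc_mult_mat_vec[OF G H(1) b] H(2) b by simp
    have row: "(\<Sum>b<s. ip a b * c $ b) = ip a s" if "a < s" for a
      using arg_cong[OF Gc, of "\<lambda>u. u $ a"] that c
      by (simp add: G_def b_def scalar_prod_def atLeast0LessThan)
    define t where "t = (\<Sum>a<s. c $ a * ip a s)"
    have "t = (\<Sum>q<r. (\<Sum>a<s. c $ a * x a q)\<^sup>2)"
      unfolding t_def gram_quadratic_form[symmetric] using row by (simp add: ip_def)
    then have t: "0 \<le> t" by (simp add: sum_nonneg)
    have "det (M t) = 0"
      by (rule kernel[of "\<lambda>a. if a < s then c $ a else - 1"])
        (use row in \<open>auto simp: t_def sym[of s] mult.commute intro!: exI[of _ s]\<close>)
    then have "det (M (ip s s)) = (ip s s - t) * det G"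
      using corner[of "ip s s" t] by simp
    also have "\<dots> \<le> ip s s * det G"
      using t nonneg by (intro mult_right_mono) auto
    finally show ?thesis by (simp add: detG detM norm)
  qed
qed

theorem hadamard_gram:
  fixes x :: "nat \<Rightarrow> nat \<Rightarrow> real"
  shows "mixed_gram_det s r (\<lambda>_. 1) x x \<le> (\<Prod>a<s. \<Sum>q<r. (x a q)\<^sup>2)"
proof (induction s)
  case 0
  show ?case by (simp add: mixed_gram_det_def)
next
  case (Suc s)
  have "mixed_gram_det (Suc s) r (\<lambda>_. 1) x x \<le>
      (\<Sum>q<r. (x s q)\<^sup>2) * mixed_gram_det s r (\<lambda>_. 1) x x"
    by (rule gram_det_Suc_le)
  also have "\<dots> \<le> (\<Sum>q<r. (x s q)\<^sup>2) * (\<Prod>a<s. \<Sum>q<r. (x a q)\<^sup>2)"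
    by (intro mult_left_mono Suc.IH sum_nonneg) simp
  finally show ?case by (simp add: mult.commute)
qed

section \<open>Dependent truncated rows\<close>

text \<open>The span is taken of a set of vectors, in which indices with equal truncations are
  identified; \<open>T\<close> contains one index for each vector of the linear combination.\<close>

lemma vec_span_proj_first_coordinates:
  assumes mem: "proj_first M y \<in> vec_span M ((\<lambda>i. proj_first M (z i)) ` S)"
    and y: "y \<in> carrier_vec r" and z: "\<And>i. i \<in> S \<Longrightarrow> z i \<in> carrier_vec r" and M: "M \<le> r"
  obtains T c where "finite T" "T \<subseteq> S" "\<And>q. q < M \<Longrightarrow> y $ q = (\<Sum>i\<in>T. c i * z i $ q)"
proof -
  interpret vec_space "TYPE(real)" M .
  let ?p = "\<lambda>i. proj_first M (z i)"
  from mem obtain d B where B: "finite B" "B \<subseteq> ?p ` S" and eq: "proj_first M y = lincomb d B"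
    unfolding span_def by auto
  from B obtain T where T: "T \<subseteq> S" "inj_on ?p T" "B = ?p ` T"
    by (metis subset_image_inj)
  have idx: "proj_first M u $ q = u $ q" if "u \<in> carrier_vec r" "q < M" for u q
    using that by (simp add: proj_first_def vec_first_def)
  show thesis
  proof (rule that[of T "\<lambda>i. d (?p i)"])
    show "finite T" using B(1) T finite_imageD by blast
    show "T \<subseteq> S" by (rule T)
    fix q assume q: "q < M"
    have "B \<subseteq> carrier_vec M" using B(2) by (auto simp: proj_first_def vec_first_def)
    then have "y $ q = (\<Sum>v\<in>B. d v * v $ q)"
      using lincomb_index[OF q, of B d] idx[OF y q] eq by simp
    also have "\<dots> = (\<Sum>i\<in>T. d (?p i) * ?p i $ q)"
      unfolding T(3) by (rule sum.reindex[OF T(2), unfolded comp_def])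
    also have "\<dots> = (\<Sum>i\<in>T. d (?p i) * z i $ q)"
      using T(1) z q idx by (intro sum.cong) auto
    finally show "y $ q = (\<Sum>i\<in>T. d (?p i) * z i $ q)" .
  qed
qed

text \<open>Only the chosen columns enter: in these, the last row is a combination of vectors each of
  which agrees with an earlier row, so the minor expands into determinants with two equal
  rows.\<close>

lemma column_minor_dependent_last_row:
  fixes x :: "nat \<Rightarrow> nat \<Rightarrow> 'a::comm_ring_1"
  assumes dep: "\<And>b. b \<le> k \<Longrightarrow> x k (f b) = (\<Sum>j\<in>T. c j * z j (f b))"
    and rows: "\<And>j. j \<in> T \<Longrightarrow> \<exists>a<k. \<forall>b\<le>k. z j (f b) = x a (f b)"
  shows "column_minor (Suc k) x f = 0"
proof -
  define N where
    "N g = mat (Suc k) (Suc k) (\<lambda>(a, b). if a = k then g b else x a (f b))" for g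
  define C where "C b = cofactor (N (\<lambda>b. x k (f b))) k b" for b
  have expand: "det (N g) = (\<Sum>b<Suc k. g b * C b)" for g
  proof -
    have "mat_delete (N g) k b = mat_delete (N h) k b" for b h
      by (intro eq_matI) (auto simp: mat_delete_def N_def)
    then have "cofactor (N g) k b = C b" for b
      unfolding cofactor_def C_def by metis
    then show ?thesis
      by (subst laplace_expansion_row[of _ "Suc k" k]) (auto simp: N_def)
  qed
  have zero: "det (N (\<lambda>b. z j (f b))) = 0" if "j \<in> T" for j
  proof -
    from rows[OF that] obtain a where "a < k" "\<forall>b\<le>k. z j (f b) = x a (f b)" by auto
    then show ?thesis
      by (intro det_identical_rows[of _ "Suc k" a k]) (auto simp: N_def intro!: eq_vecI)
  qed
  have "column_minor (Suc k) x f = det (N (\<lambda>b. x k (f b)))"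
    unfolding column_minor_def N_def by (intro arg_cong[of _ _ det] eq_matI) auto
  also have "\<dots> = (\<Sum>b<Suc k. \<Sum>j\<in>T. c j * (z j (f b) * C b))"
    unfolding expand using dep by (intro sum.cong refl) (simp add: sum_distrib_right mult.assoc)
  also have "\<dots> = (\<Sum>j\<in>T. c j * det (N (\<lambda>b. z j (f b))))"
    unfolding expand sum_distrib_left by (rule sum.swap)
  also have "\<dots> = 0" using zero by simp
  finally show ?thesis .
qed

lemma weighted_gram_det_le_of_truncated_dependence:
  fixes z :: "nat \<Rightarrow> real vec"
  assumes z: "\<And>i. i \<in> insert l (set I) \<Longrightarrow> z i \<in> carrier_vec r \<and> euclid_norm (z i) \<le> 1"
    and M: "M \<le> r"
    and w: "\<And>q. q < r \<Longrightarrow> 0 \<le> w q \<and> w q \<le> 1"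
    and t: "0 \<le> t" "\<And>q. M \<le> q \<Longrightarrow> q < r \<Longrightarrow> w q \<le> t"
    and mem: "proj_first M (z l) \<in> vec_span M ((\<lambda>i. proj_first M (z i)) ` set I)"
  defines "x \<equiv> \<lambda>a q. (map z I @ [z l]) ! a $ q"
  shows "mixed_gram_det (Suc (length I)) r w x x \<le> t"
proof -
  let ?k = "length I"
  obtain T c where T: "T \<subseteq> set I"
    and dep: "\<And>q. q < M \<Longrightarrow> z l $ q = (\<Sum>i\<in>T. c i * z i $ q)"
    using vec_span_proj_first_coordinates[OF mem, of r] z M by (metis insertCI)
  have "column_minor (Suc ?k) x f = 0" if "\<And>a. a < Suc ?k \<Longrightarrow> f a < M" for f
  proof (rule column_minor_dependent_last_row)
    fix b assume "b \<le> ?k"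
    then show "x ?k (f b) = (\<Sum>i\<in>T. c i * z i $ f b)"
      using dep that by (simp add: x_def nth_append)
  next
    fix i assume "i \<in> T"
    with T obtain a where "a < ?k" "I ! a = i" by (metis in_set_conv_nth subsetD)
    then show "\<exists>a<?k. \<forall>b\<le>?k. z i $ f b = x a (f b)"
      by (intro exI[of _ a]) (simp add: x_def nth_append)
  qed
  then have "mixed_gram_det (Suc ?k) r w x x \<le> t * mixed_gram_det (Suc ?k) r (\<lambda>_. 1) x x"
    using w t by (intro mixed_gram_det_le_of_vanishing_minors) auto
  also have "\<dots> \<le> t * (\<Prod>a<Suc ?k. \<Sum>q<r. (x a q)\<^sup>2)"
    by (intro mult_left_mono hadamard_gram t)
  also have "\<dots> \<le> t * 1"
  proof (intro mult_left_mono t prod_le_1 conjI sum_nonneg)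
    fix a assume "a \<in> {..<Suc ?k}"
    then have a: "a < length (I @ [l])" by simp
    define i where "i = (I @ [l]) ! a"
    have "i \<in> set (I @ [l])" unfolding i_def by (rule nth_mem[OF a])
    moreover have "map z (I @ [l]) ! a = z i" unfolding i_def by (rule nth_map[OF a])
    ultimately have i: "i \<in> insert l (set I)" "(map z I @ [z l]) ! a = z i" by simp_all
    have "(\<Sum>q<r. (x a q)\<^sup>2) = (\<Sum>q<r. z i $ q * z i $ q)"
      unfolding x_def i(2) by (simp add: power2_eq_square)
    also have "\<dots> \<le> 1"
      using z[OF i(1)] by (auto simp: euclid_norm_def scalar_prod_def atLeast0LessThan)
    finally show "(\<Sum>q<r. (x a q)\<^sup>2) \<le> 1" .
  qed simp
  finally show ?thesis by simp
qed

section \<open>The bound on the pairing of blades\<close>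

theorem theorem2p5:
  fixes n m r k :: nat
    and A U V :: "real mat"
    and \<sigma> :: "nat \<Rightarrow> real"
    and I J :: "nat list"
    and l p M1 M2 :: nat
  defines "u \<equiv> row U" and "v \<equiv> row V"
  assumes "A \<in> carrier_mat n m"
    and "vec_space.rank n A = r"
    and "thin_svd n m r A U \<sigma> V"
    and "\<sigma> 1 = 1"
    and "length I = k" and "set I \<subseteq> {..<n}"
    and "length J = k" and "set J \<subseteq> {..<m}"
    and "l < n" and "p < m"
    and "\<forall>i\<in>insert l (set I). euclid_norm (u i) \<le> 1"
    and "\<forall>j\<in>insert p (set J). euclid_norm (v j) \<le> 1"
    and "k \<le> M1" and "M1 \<le> r" and "k \<le> M2" and "M2 \<le> r"
    and "proj_first M1 (u l) \<in> vec_span M1 ((\<lambda>i. proj_first M1 (u i)) ` set I)"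
    and "proj_first M2 (v p) \<in> vec_span M2 ((\<lambda>j. proj_first M2 (v j)) ` set J)"
  shows "\<bar>ext_inner r (k + 1) \<sigma> (wedge r (map u I @ [u l])) (wedge r (map v J @ [v p]))\<bar>
           \<le> sqrt (\<sigma> (M1 + 1) * \<sigma> (M2 + 1))"
proof -
  have U: "U \<in> carrier_mat n r" and V: "V \<in> carrier_mat m r"
    and anti: "\<And>q q'. 1 \<le> q \<Longrightarrow> q \<le> q' \<Longrightarrow> q' \<le> r \<Longrightarrow> \<sigma> q' \<le> \<sigma> q"
    and pos: "\<And>q. 1 \<le> q \<Longrightarrow> q \<le> r \<Longrightarrow> 0 < \<sigma> q" and last: "\<sigma> (r + 1) = 0"
    using assms(5) unfolding thin_svd_def by auto
  define w where "w q = \<sigma> (Suc q)" for q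
  define x where "x = (\<lambda>a q. (map u I @ [u l]) ! a $ q)"
  define y where "y = (\<lambda>a q. (map v J @ [v p]) ! a $ q)"
  have w: "0 \<le> w q \<and> w q \<le> 1" if "q < r" for q
    using anti[of 1 "Suc q"] pos[of "Suc q"] that \<open>\<sigma> 1 = 1\<close> by (simp add: w_def)
  \<comment> \<open>For \<open>M = r\<close> the bound is the conventional value \<open>\<sigma> (r + 1) = 0\<close>.\<close>
  have t: "0 \<le> \<sigma> (M + 1)" if "M \<le> r" for M
    using pos[of "M + 1"] last that by (cases "M = r") auto
  have le_t: "w q \<le> \<sigma> (M + 1)" if "M \<le> q" "q < r" for M q
    using anti[of "M + 1" "Suc q"] that by (simp add: w_def)
  have u: "u i \<in> carrier_vec r" for i using U by (auto simp: u_def)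
  have v: "v j \<in> carrier_vec r" for j using V by (auto simp: v_def)
  have "ext_inner r (k + 1) \<sigma> (wedge r (map u I @ [u l])) (wedge r (map v J @ [v p])) =
      mixed_gram_det (Suc k) r w x y"
    using u v \<open>length I = k\<close> \<open>length J = k\<close>
    by (subst ext_inner_wedge)
      (auto simp: tuples_def mixed_gram_det_def weighted_inner_def w_def x_def y_def)
  then have "\<bar>ext_inner r (k + 1) \<sigma> (wedge r (map u I @ [u l])) (wedge r (map v J @ [v p]))\<bar> \<le>
      sqrt (mixed_gram_det (Suc k) r w x x * mixed_gram_det (Suc k) r w y y)"
    using mixed_gram_det_cauchy_schwarz[of r w "Suc k" x y] w by simp
  also have "\<dots> \<le> sqrt (\<sigma> (M1 + 1) * \<sigma> (M2 + 1))"
  proof (intro real_sqrt_le_mono mult_mono t mixed_gram_det_self_nonneg)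
    show "mixed_gram_det (Suc k) r w x x \<le> \<sigma> (M1 + 1)"
      unfolding x_def \<open>length I = k\<close>[symmetric]
      using assms u w t le_t by (intro weighted_gram_det_le_of_truncated_dependence[where M = M1]) auto
    show "mixed_gram_det (Suc k) r w y y \<le> \<sigma> (M2 + 1)"
      unfolding y_def \<open>length J = k\<close>[symmetric]
      using assms v w t le_t by (intro weighted_gram_det_le_of_truncated_dependence[where M = M2]) auto
  qed (use assms w in auto)
  finally show ?thesis .
qed

end
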